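(* Let $(m,n,r)$ be a triple of natural numbers with $m,n\ge 1$, $\gcd(m,n)=\gcd(m,r-1)=1$ and $r^n\equiv 1 \pmod m$, and let $ZM(m,n,r)=\langle a,b \mid a^m=b^n=1,\ b^{-1}ab=a^r\rangle$. Suppose that $n$ is a prime number. Then (i) $$sd(ZM(m,n,r))=\frac{\tau(m)^2+2\tau(m)\sigma(m)+g(m)}{(\tau(m)+\sigma(m))^2};$$ (ii) $$csd(ZM(m,n,r))=\frac{\tau(m)(\tau(m)+m)+m(\tau(m)+1)}{(\tau(m)+m)^2}.$$
   Context: For a finite group $G$, $L(G)$ denotes the set of all subgroups of $G$ and $L_1(G)$ the set of all cyclic subgroups of $G$. The subgroup commutativity degree and the cyclic subgroup commutativity degree of $G$ are $sd(G)=\frac{1}{|L(G)|^2}|\{(H,K)\in L(G)^2\mid HK=KH\}|$ and $csd(G)=\frac{1}{|L_1(G)|^2}|\{(H,K)\in L_1(G)^2\mid HK=KH\}|$, where $HK=\{hk\mid h\in H,k\in K\}$. A ZM-group $ZM(m,n,r)$ is the finite group of order $mn$ given by the presentation in the claim under the stated conditions on $(m,n,r)$. For a positive integer $k$, $\tau(k)$ is the number of positive divisors of $k$, $\sigma(k)$ is the sum of the positive divisors of $k$, and $g(k)=k\sum_{u\mid k,\ v\mid k}\frac{1}{\gcd(u,v)}$, the sum being over all ordered pairs $(u,v)$ of positive divisors of $k$. *)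

theory Defs
  imports Complex_Main "HOL-Number_Theory.Cong" "HOL-Algebra.Generated_Groups"
begin

text \<open>
  A word over a set of generators is a list of letters: \<open>(x, True)\<close> stands for the
  generator \<open>x\<close> and \<open>(x, False)\<close> for its formal inverse.
\<close>

type_synonym 'a word = "('a \<times> bool) list"

text \<open>
  A relation \<open>u = v\<close> between words is a pair \<open>(u, v)\<close>. The words representing equal elements
  of the group presented by \<open>R\<close> are those related by the least congruence on the monoid of words
  that contains \<open>R\<close> and makes \<open>(x, True)\<close> and \<open>(x, False)\<close> inverse to each other.
\<close>

inductive word_eq :: "('a word \<times> 'a word) set \<Rightarrow> 'a word \<Rightarrow> 'a word \<Rightarrow> bool"
  for R :: "('a word \<times> 'a word) set" where
  rel: "(u, v) \<in> R \<Longrightarrow> word_eq R u v"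
| cancel: "word_eq R [(x, e), (x, \<not> e)] []"
| refl: "word_eq R u u"
| sym: "word_eq R u v \<Longrightarrow> word_eq R v u"
| trans: "word_eq R u v \<Longrightarrow> word_eq R v w \<Longrightarrow> word_eq R u w"
| append: "word_eq R u u' \<Longrightarrow> word_eq R v v' \<Longrightarrow> word_eq R (u @ v) (u' @ v')"

definition word_class :: "('a word \<times> 'a word) set \<Rightarrow> 'a word \<Rightarrow> 'a word set" where
  "word_class R u = {v. word_eq R u v}"

definition presented_group :: "('a word \<times> 'a word) set \<Rightarrow> 'a word set monoid" where
  "presented_group R =
    \<lparr>carrier = range (word_class R),
     mult = (\<lambda>A B. \<Union>u\<in>A. \<Union>v\<in>B. word_class R (u @ v)),
     one = word_class R []\<rparr>"

lemma word_class_eq_iff: "word_class R u = word_class R v \<longleftrightarrow> word_eq R u v"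
proof
  assume "word_class R u = word_class R v"
  then have "v \<in> word_class R u"
    by (simp add: word_class_def word_eq.refl)
  then show "word_eq R u v"
    by (simp add: word_class_def)
next
  assume uv: "word_eq R u v"
  have "word_eq R u w \<longleftrightarrow> word_eq R v w" for w
    using word_eq.trans[OF uv] word_eq.trans[OF word_eq.sym[OF uv]] by metis
  then show "word_class R u = word_class R v"
    by (simp add: word_class_def)
qed

lemma presented_group_mult:
  "word_class R u \<otimes>\<^bsub>presented_group R\<^esub> word_class R v = word_class R (u @ v)"
proof -
  have "word_class R (u' @ v') = word_class R (u @ v)"
    if "u' \<in> word_class R u" "v' \<in> word_class R v" for u' v'
    using that word_eq.append[of R u u' v v'] word_class_eq_iff[of R "u @ v" "u' @ v'"]
    by (simp add: word_class_def)
  moreover have "u \<in> word_class R u" "v \<in> word_class R v"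
    by (simp_all add: word_class_def word_eq.refl)
  ultimately have "(\<Union>u'\<in>word_class R u. \<Union>v'\<in>word_class R v. word_class R (u' @ v'))
      = word_class R (u @ v)"
    by blast
  then show ?thesis
    by (simp add: presented_group_def)
qed

lemma word_eq_left_inverse: "\<exists>v. word_eq R (v @ u) []"
proof (induction u)
  case Nil
  have "word_eq R ([] @ []) []" by (simp add: word_eq.refl)
  then show ?case by blast
next
  case (Cons a u)
  obtain x e where a: "a = (x, e)" by (cases a)
  from Cons obtain v where v: "word_eq R (v @ u) []" by blast
  have "word_eq R ([(x, \<not> e), (x, e)] @ u) ([] @ u)"
    using word_eq.append[OF word_eq.cancel[of R x "\<not> e"] word_eq.refl[of R u]] by simp
  then have "word_eq R (v @ ((x, \<not> e) # (x, e) # u)) (v @ u)"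
    using word_eq.append[OF word_eq.refl[of R v], of "[(x, \<not> e), (x, e)] @ u" "[] @ u"] by simp
  then have "word_eq R ((v @ [(x, \<not> e)]) @ a # u) []"
    using word_eq.trans[OF _ v] by (simp add: a)
  then show ?case by blast
qed

lemma group_presented_group: "group (presented_group R)"
proof -
  have carrier: "carrier (presented_group R) = range (word_class R)"
    and one: "\<one>\<^bsub>presented_group R\<^esub> = word_class R []"
    by (simp_all add: presented_group_def)
  have left_inverse: "\<exists>v. word_class R (v @ u) = word_class R []" for u
    using word_eq_left_inverse[of R u] by (simp only: word_class_eq_iff)
  show ?thesis
    by (rule groupI)
      (auto simp add: carrier one presented_group_mult left_inverse)
qed

datatype zm_gen = gen_a | gen_b

definition ZM :: "nat \<Rightarrow> nat \<Rightarrow> nat \<Rightarrow> zm_gen word set monoid" where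
  "ZM m n r = presented_group
    {(replicate m (gen_a, True), []),
     (replicate n (gen_b, True), []),
     ([(gen_b, False), (gen_a, True), (gen_b, True)], replicate r (gen_a, True))}"

definition all_subgroups :: "('a, 'b) monoid_scheme \<Rightarrow> 'a set set" where
  "all_subgroups G = {H. subgroup H G}"

definition cyclic_subgroups :: "('a, 'b) monoid_scheme \<Rightarrow> 'a set set" where
  "cyclic_subgroups G = {H. subgroup H G \<and> (\<exists>x\<in>carrier G. H = generate G {x})}"

definition sd :: "('a, 'b) monoid_scheme \<Rightarrow> real" where
  "sd G = real (card {(H, K) \<in> all_subgroups G \<times> all_subgroups G. H <#>\<^bsub>G\<^esub> K = K <#>\<^bsub>G\<^esub> H})
    / real ((card (all_subgroups G))\<^sup>2)"

definition csd :: "('a, 'b) monoid_scheme \<Rightarrow> real" where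
  "csd G = real (card {(H, K) \<in> cyclic_subgroups G \<times> cyclic_subgroups G. H <#>\<^bsub>G\<^esub> K = K <#>\<^bsub>G\<^esub> H})
    / real ((card (cyclic_subgroups G))\<^sup>2)"

definition divisor_tau :: "nat \<Rightarrow> nat" where
  "divisor_tau k = card {d. d dvd k}"

definition divisor_sigma :: "nat \<Rightarrow> nat" where
  "divisor_sigma k = \<Sum>{d. d dvd k}"

definition divisor_g :: "nat \<Rightarrow> real" where
  "divisor_g k = real k * (\<Sum>(u, v)\<in>{d. d dvd k} \<times> {d. d dvd k}. 1 / real (gcd u v))"

end

theory Submission
  imports Defs "HOL-Computational_Algebra.Group_Closure"
begin

text \<open>
  Since \<open>r ^ n\<close> is \<open>1\<close> modulo \<open>m\<close>, the group acts on the right on the integers modulo \<open>m\<close>, the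
  element \<open>b ^ i * a ^ j\<close> acting as \<open>x \<mapsto> r ^ i * x + j\<close>. As \<open>n\<close> is prime and \<open>r - 1\<close> is a unit
  modulo \<open>m\<close>, a subgroup that is not contained in the translations \<open>\<langle>a\<rangle>\<close> contains a full conjugate
  of \<open>\<langle>b\<rangle>\<close>, that is, the stabilizer of a point \<open>x\<close>, and is therefore the stabilizer of the residue
  class of \<open>x\<close> modulo some \<open>d\<close> dividing \<open>m\<close>. Subgroups of \<open>\<langle>a\<rangle>\<close> are normal and commute with
  everything, and the stabilizers of \<open>x\<close> modulo \<open>u\<close> and of \<open>y\<close> modulo \<open>v\<close> commute if and only if
  \<open>gcd u v\<close> divides \<open>x - y\<close>. For fixed \<open>u\<close> and \<open>v\<close> this holds for \<open>lcm u v\<close> pairs of residue classes,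
  and replacing \<open>u\<close>, \<open>v\<close> by the complementary divisors turns the sum of the least common multiples
  into \<open>g m\<close>.
\<close>

section \<open>Arithmetic of divisors and residue classes\<close>

text \<open>Closure under differences makes \<open>J\<close> equal to its own
  \<open>group_closure\<close>, and a group of integers consists of the multiples of its
  \<open>Gcd\<close>. The assumption \<open>int m \<in> J\<close> yields both
  \<open>0 \<in> J\<close> and \<open>d dvd m\<close>.\<close>

lemma int_subgroup_eq_multiples:
  fixes J :: "int set" and m :: nat
  assumes "int m \<in> J" and diff: "\<And>i j. i \<in> J \<Longrightarrow> j \<in> J \<Longrightarrow> i - j \<in> J"
  obtains d where "d dvd m" "J = {j. int d dvd j}"
proof -
  have "0 \<in> J" using diff[OF assms(1) assms(1)] by simp
  have "s \<in> J" if "s \<in> group_closure J" for s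
    using that by induction (use \<open>0 \<in> J\<close> diff in auto)
  then have "J = group_closure J"
    by (auto intro: group_closure.base)
  then have J: "J = {j. Gcd J dvd j}"
    by (subst (asm) group_closure_eq) (auto simp: dvd_def)
  define d where "d = nat (Gcd J)"
  have d: "int d = Gcd J" by (simp add: d_def)
  show thesis
  proof
    show "d dvd m"
      using assms(1) d by (simp flip: int_dvd_int_iff)
    show "J = {j. int d dvd j}" unfolding d by (rule J)
  qed
qed

text \<open>Chinese remaindering for moduli that may share factors: by Bezout,
  \<open>x - y = k * (p * u + q * v)\<close>, so subtracting the \<open>u\<close>-part from
  \<open>x\<close> leaves a number that differs from \<open>y\<close> by a multiple of
  \<open>v\<close>.\<close>

lemma exists_int_cong_both:
  fixes x y u v :: int
  assumes "gcd u v dvd x - y"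
  obtains z where "u dvd z - x" "v dvd z - y"
proof -
  obtain p q where pq: "p * u + q * v = gcd u v" using bezout_int by blast
  obtain k where k: "x - y = gcd u v * k" using assms by blast
  show thesis
  proof
    show "u dvd (x - k * p * u) - x" by simp
    have "(x - k * p * u) - y = (p * u + q * v) * k - k * p * u"
      using k pq by simp
    also have "\<dots> = v * (k * q)" by (simp add: algebra_simps)
    finally have "(x - k * p * u) - y = v * (k * q)" .
    then show "v dvd (x - k * p * u) - y" by simp
  qed
qed

lemma power_cong_exponent:
  assumes "[k = i] (mod n)" "[(b::int) ^ n = 1] (mod m)"
  shows "[b ^ k = b ^ i] (mod m)"
proof -
  have "[b ^ k = b ^ (k mod n)] (mod m)" for k
  proof -
    have "b ^ k = (b ^ n) ^ (k div n) * b ^ (k mod n)"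
      by (simp flip: power_mult power_add)
    also have "[\<dots> = 1 ^ (k div n) * b ^ (k mod n)] (mod m)"
      by (intro cong_mult cong_pow assms(2) cong_refl)
    finally show ?thesis by simp
  qed
  from this[of k] this[of i] show ?thesis
    using assms(1) by (simp add: cong_def)
qed

text \<open>Reduction modulo \<open>u\<close> and modulo \<open>v\<close> maps the residues modulo
  \<open>lcm u v\<close> bijectively onto the compatible pairs; surjectivity is
  \<open>exists_int_cong_both\<close>.\<close>

lemma card_compatible_residues:
  assumes "u > 0" "v > 0"
  shows "card {(x, y). x \<in> {0..<int u} \<and> y \<in> {0..<int v} \<and> int (gcd u v) dvd x - y} = lcm u v"
proof -
  let ?f = "\<lambda>z. (z mod int u, z mod int v)"
  let ?S = "{(x, y). x \<in> {0..<int u} \<and> y \<in> {0..<int v} \<and> int (gcd u v) dvd x - y}"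
  have "inj_on ?f {0..<int (lcm u v)}"
  proof (rule inj_onI)
    fix z w assume z: "z \<in> {0..<int (lcm u v)}" and w: "w \<in> {0..<int (lcm u v)}"
      and "?f z = ?f w"
    then have "int u dvd z - w" "int v dvd z - w"
      by (simp_all add: mod_eq_dvd_iff)
    then have "lcm (int u) (int v) dvd z - w" by (rule lcm_least)
    then have "z mod lcm (int u) (int v) = w mod lcm (int u) (int v)"
      by (simp add: mod_eq_dvd_iff)
    then show "z = w" using z w by simp
  qed
  moreover have "?f ` {0..<int (lcm u v)} = ?S"
  proof (intro equalityI subsetI)
    fix p assume "p \<in> ?f ` {0..<int (lcm u v)}"
    then obtain z where p: "p = ?f z" by blast
    have "z mod int u - z mod int v = int v * (z div int v) - int u * (z div int u)"
      by (simp add: minus_div_mult_eq_mod[symmetric] mult.commute)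
    then have "int (gcd u v) dvd z mod int u - z mod int v"
      by (simp only:) (intro dvd_diff dvd_mult2; simp)
    then show "p \<in> ?S" using assms by (simp add: p)
  next
    fix p assume "p \<in> ?S"
    then obtain x y where p: "p = (x, y)" "x \<in> {0..<int u}" "y \<in> {0..<int v}"
      and "gcd (int u) (int v) dvd x - y" by auto
    from this(4) obtain z where "int u dvd z - x" "int v dvd z - y"
      by (rule exists_int_cong_both)
    then have "z mod int u = x mod int u" "z mod int v = y mod int v"
      by (simp_all add: mod_eq_dvd_iff)
    moreover define w where "w = z mod int (lcm u v)"
    ultimately have "?f w = p"
      using p(2,3) by (simp add: p(1) mod_mod_cancel)
    moreover have "w \<in> {0..<int (lcm u v)}" using assms by (simp add: w_def lcm_pos_nat)
    ultimately show "p \<in> ?f ` {0..<int (lcm u v)}" by blast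
  qed
  ultimately have "card ?S = card {0..<int (lcm u v)}" by (metis card_image)
  also have "\<dots> = lcm u v" by (simp only: card_atLeastLessThan_int diff_0_right nat_int)
  finally show ?thesis .
qed

text \<open>With \<open>a\<close> and \<open>b\<close> the complementary divisors, multiplying
  \<open>gcd u v\<close> by \<open>a * b\<close> gives \<open>m * gcd a b\<close>; writing
  \<open>a * b\<close> as \<open>gcd a b * lcm a b\<close> lets \<open>gcd a b\<close>
  cancel.\<close>

lemma lcm_codivisors_mult_gcd:
  fixes u v m :: nat
  assumes "m > 0" "u dvd m" "v dvd m"
  shows "lcm (m div u) (m div v) * gcd u v = m"
proof -
  define a b where "a = m div u" and "b = m div v"
  have m: "u * a = m" "v * b = m" using assms by (simp_all add: a_def b_def)
  then have pos: "gcd a b > 0" using assms(1) by (metis gcd_pos_nat mult_0_right not_gr_zero)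
  have "gcd u v * (a * b) = gcd (u * a * b) (v * b * a)"
    by (simp add: gcd_mult_distrib_nat mult_ac)
  also have "\<dots> = m * gcd a b"
    unfolding m by (simp add: gcd_mult_distrib_nat gcd.commute)
  finally have "gcd u v * (a * b) = m * gcd a b" .
  moreover have "gcd u v * (a * b) = (lcm a b * gcd u v) * gcd a b"
    unfolding prod_gcd_lcm_nat[of a b] by (simp only: mult_ac)
  ultimately have "(lcm a b * gcd u v) * gcd a b = m * gcd a b" by (simp only:)
  with pos have "lcm a b * gcd u v = m" by (metis mult_cancel2 less_not_refl)
  then show ?thesis by (simp only: a_def b_def)
qed

lemma sum_lcm_divisors:
  assumes "m > 0"
  shows "(\<Sum>(u, v)\<in>{d. d dvd m} \<times> {d. d dvd m}. real (lcm u v)) = divisor_g m"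
proof -
  let ?D = "{d. d dvd m} \<times> {d. d dvd m}"
  let ?f = "\<lambda>(u, v). (m div u, m div v)"
  have "(\<Sum>(u, v)\<in>?D. real (lcm u v)) = (\<Sum>(u, v)\<in>?D. real (lcm (m div u) (m div v)))"
  proof (rule sum.reindex_bij_witness[of _ ?f ?f])
  qed (use assms in \<open>auto simp: div_div_eq_right\<close>)
  also have "\<dots> = (\<Sum>(u, v)\<in>?D. real m * (1 / real (gcd u v)))"
  proof (rule sum.cong)
    fix p assume "p \<in> ?D"
    then obtain u v where p: "p = (u, v)" "u dvd m" "v dvd m" by auto
    have "real (lcm (m div u) (m div v)) * real (gcd u v) = real m"
      using lcm_codivisors_mult_gcd[OF assms p(2,3)] by (simp only: flip: of_nat_mult)
    moreover have "gcd u v > 0" using p assms by (auto intro: Nat.gr0I)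
    ultimately show "(case p of (u, v) \<Rightarrow> real (lcm (m div u) (m div v)))
        = (case p of (u, v) \<Rightarrow> real m * (1 / real (gcd u v)))"
      by (simp add: p field_simps)
  qed simp
  also have "\<dots> = divisor_g m"
    by (simp add: divisor_g_def sum_distrib_left case_prod_unfold)
  finally show ?thesis .
qed

section \<open>Subgroups of a group of affine maps\<close>

text \<open>In a product of two elements of \<open>H <#> K\<close> the inner \<open>K <#> H\<close>
  may be swapped, and inversion turns \<open>H <#> K\<close> into \<open>K <#> H\<close>. This is
  how commutation is exploited in \<open>stab_commute_iff\<close>.\<close>

lemma (in group) subgroup_set_mult:
  assumes "subgroup H G" "subgroup K G" and comm: "H <#> K = K <#> H"
  shows "subgroup (H <#> K) G"
proof -
  have sub: "H \<subseteq> carrier G" "K \<subseteq> carrier G"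
    using assms by (auto dest: subgroup.subset)
  show ?thesis
  proof (rule subgroupI)
    show "H <#> K \<subseteq> carrier G" using sub by (rule set_mult_closed)
    show "H <#> K \<noteq> {}"
      using assms(1,2) subgroup.one_closed unfolding set_mult_def by blast
  next
    fix a assume "a \<in> H <#> K"
    then obtain h k where hk: "h \<in> H" "k \<in> K" "a = h \<otimes> k"
      unfolding set_mult_def by blast
    then have "inv a = inv k \<otimes> inv h" using sub by (auto intro: inv_mult_group)
    then have "inv a \<in> K <#> H"
      using hk assms(1,2) unfolding set_mult_def by (blast intro: subgroup.m_inv_closed)
    then show "inv a \<in> H <#> K" by (simp add: comm)
  next
    fix a b assume "a \<in> H <#> K" "b \<in> H <#> K"
    then have "a \<otimes> b \<in> (H <#> K) <#> (H <#> K)"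
      unfolding set_mult_def by blast
    also have "(H <#> K) <#> (H <#> K) = H <#> (K <#> H) <#> K"
      using sub by (simp add: set_mult_assoc set_mult_closed)
    also have "\<dots> = (H <#> H) <#> (K <#> K)"
      using sub by (simp add: set_mult_assoc set_mult_closed flip: comm)
    also have "\<dots> = H <#> K"
      using assms(1,2) by (simp add: subgroup_mult_id)
    finally show "a \<otimes> b \<in> H <#> K" .
  qed
qed

text \<open>\<open>e i j\<close> stands for \<open>b ^ i * a ^ j\<close>. The exponent of
  \<open>b\<close> is a natural number so that \<open>r ^ k\<close> makes sense without inverting
  \<open>r\<close>; the names are not unique, and \<open>e_eq_iff\<close> says when two of them
  agree.\<close>

locale affine_coordinates = group G for G (structure) +
  fixes m n :: nat and r :: int and e :: "nat \<Rightarrow> int \<Rightarrow> 'a"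
  assumes m_pos: "m > 0"
    and prime_n: "prime n"
    and coprime_r1: "coprime (int m) (r - 1)"
    and r_pow_n: "[r ^ n = 1] (mod int m)"
    and carrier_eq: "carrier G = {e i j | i j. True}"
    and e_mult: "e i j \<otimes> e k l = e (i + k) (j * r ^ k + l)"
    and e_eq_iff: "e i j = e k l \<longleftrightarrow> [i = k] (mod n) \<and> [j = l] (mod int m)"
begin

lemma e_closed [simp]: "e i j \<in> carrier G"
  by (auto simp: carrier_eq)

lemma e_one: "e 0 0 = \<one>"
  using e_mult[of 0 0 0 0] by simp

lemma n_gt_1: "n > 1"
  using prime_n by (rule prime_gt_1_nat)

lemma pow_cong: "[i = k] (mod n) \<Longrightarrow> [r ^ i = r ^ k] (mod int m)"
  by (rule power_cong_exponent[OF _ r_pow_n])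

lemma pow_cong_1: "n dvd i \<Longrightarrow> [r ^ i = 1] (mod int m)"
  using pow_cong[of i 0] by (simp add: cong_0_iff)

lemma pow_dvd_diff_1: "n dvd i \<Longrightarrow> d dvd m \<Longrightarrow> int d dvd r ^ i - 1"
  by (metis cong_iff_dvd_diff pow_cong_1 dvd_trans int_dvd_int_iff)

lemma coprime_pow: "coprime (int m) (r ^ k)"
proof -
  have "coprime (int m) (r ^ n)"
    using r_pow_n by (metis cong_imp_coprime cong_sym coprime_1_right coprime_commute)
  then have "coprime (int m) r"
    using n_gt_1 by (simp add: coprime_power_right_iff)
  then show ?thesis by simp
qed

text \<open>Since exponents of \<open>b\<close> are natural numbers, \<open>i * (n - 1)\<close>
  serves as the negative of \<open>i\<close> modulo \<open>n\<close>.\<close>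

lemma n_dvd_add_mult: "n dvd i + i * (n - 1)"
  using n_gt_1 by (metis dvd_triv_right le_add_diff_inverse less_imp_le mult.right_neutral distrib_left)

lemma inv_e: "inv (e i j) = e (i * (n - 1)) (- (j * r ^ (i * (n - 1))))"
proof (rule inv_equality)
  have "[r ^ (i * (n - 1)) * r ^ i = 1] (mod int m)"
    using pow_cong_1[OF n_dvd_add_mult] by (simp add: power_add mult.commute)
  from cong_scalar_left[OF this, of "- j"]
  have "e (i * (n - 1) + i) (- (j * r ^ (i * (n - 1))) * r ^ i + j) = e 0 0"
    using n_dvd_add_mult[of i] unfolding e_eq_iff
    by (simp add: cong_0_iff cong_iff_dvd_diff algebra_simps)
  then show "e (i * (n - 1)) (- (j * r ^ (i * (n - 1)))) \<otimes> e i j = \<one>"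
    by (simp add: e_mult e_one)
qed simp_all

section \<open>Translation subgroups and stabilizers of residue classes\<close>

definition transl :: "nat \<Rightarrow> 'a set" where
  "transl d = {e 0 j | j. int d dvd j}"

text \<open>The condition means that \<open>r ^ i * x + j\<close> is congruent to \<open>x\<close>
  modulo \<open>d\<close>: the affine map of \<open>e i j\<close> fixes the residue class of
  \<open>x\<close>.\<close>

definition stab :: "nat \<Rightarrow> int \<Rightarrow> 'a set" where
  "stab d x = {e i j | i j. int d dvd (r ^ i - 1) * x + j}"

text \<open>The definition only asks for some suitable name of the element. Since \<open>d\<close>
  divides \<open>m\<close>, divisibility by \<open>d\<close> does not depend on the name chosen; the
  same holds in \<open>mem_stab_iff\<close>.\<close>

lemma mem_transl_iff:
  assumes "d dvd m"
  shows "e i j \<in> transl d \<longleftrightarrow> n dvd i \<and> int d dvd j"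
proof -
  have "int d dvd j \<longleftrightarrow> int d dvd j'" if "[j = j'] (mod int m)" for j'
    using that assms by (meson cong_dvd_iff cong_dvd_modulus int_dvd_int_iff)
  then show ?thesis
    unfolding transl_def e_eq_iff mem_Collect_eq cong_0_iff by (meson cong_refl)
qed

lemma mem_stab_iff:
  assumes "d dvd m"
  shows "e i j \<in> stab d x \<longleftrightarrow> int d dvd (r ^ i - 1) * x + j"
proof -
  have "int d dvd (r ^ i - 1) * x + j \<longleftrightarrow> int d dvd (r ^ k - 1) * x + l"
    if "[i = k] (mod n)" "[j = l] (mod int m)" for k l
  proof -
    have "[(r ^ i - 1) * x + j = (r ^ k - 1) * x + l] (mod int m)"
      by (intro cong_add cong_mult cong_diff pow_cong that cong_refl)
    then show ?thesis
      using assms by (meson cong_dvd_iff cong_dvd_modulus int_dvd_int_iff)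
  qed
  then show ?thesis
    unfolding stab_def e_eq_iff mem_Collect_eq by (meson cong_refl)
qed

lemma carrier_cases:
  assumes "a \<in> carrier G"
  obtains i j where "a = e i j"
  using assms by (auto simp: carrier_eq)

lemma subgroup_transl:
  assumes "d dvd m"
  shows "subgroup (transl d) G"
proof (rule subgroupI)
  show "transl d \<subseteq> carrier G" by (auto simp: transl_def)
  show "transl d \<noteq> {}" unfolding transl_def using dvd_0_right by blast
next
  fix a assume "a \<in> transl d"
  then obtain j where "a = e 0 j" "int d dvd j" by (auto simp: transl_def)
  then show "inv a \<in> transl d" by (simp add: inv_e mem_transl_iff assms)
next
  fix a b assume "a \<in> transl d" "b \<in> transl d"
  then obtain j k where "a = e 0 j" "int d dvd j" "b = e 0 k" "int d dvd k"
    by (auto simp: transl_def)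
  then show "a \<otimes> b \<in> transl d" by (simp add: e_mult mem_transl_iff assms)
qed

lemma subgroup_stab:
  assumes "d dvd m"
  shows "subgroup (stab d x) G"
proof (rule subgroupI)
  show "stab d x \<subseteq> carrier G" by (auto simp: stab_def)
  have "e 0 0 \<in> stab d x" by (simp add: mem_stab_iff assms)
  then show "stab d x \<noteq> {}" by blast
next
  fix a assume "a \<in> stab d x"
  then obtain i j where a: "a = e i j" and d: "int d dvd (r ^ i - 1) * x + j"
    by (auto simp: stab_def)
  \<comment> \<open>The \<open>b\<close>-exponent of the inverse. As \<open>n dvd i + k\<close>, the
    powers \<open>r ^ i\<close> and \<open>r ^ k\<close> are inverse modulo \<open>d\<close>, so
    multiplying the condition on \<open>a\<close> by \<open>r ^ k\<close> gives the one on
    \<open>inv a\<close>.\<close>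
  define k where "k = i * (n - 1)"
  have "int d dvd r ^ (i + k) - 1"
    using assms n_dvd_add_mult[of i] unfolding k_def by (intro pow_dvd_diff_1)
  then have "int d dvd (r ^ (i + k) - 1) * x - r ^ k * ((r ^ i - 1) * x + j)"
    using d by (rule dvd_diff[OF dvd_mult2 dvd_mult])
  also have "(r ^ (i + k) - 1) * x - r ^ k * ((r ^ i - 1) * x + j) = (r ^ k - 1) * x + - (j * r ^ k)"
    by (simp add: power_add algebra_simps)
  finally show "inv a \<in> stab d x"
    unfolding a inv_e k_def[symmetric] using assms by (simp add: mem_stab_iff)
next
  fix a b assume "a \<in> stab d x" "b \<in> stab d x"
  then obtain i j k l where ab: "a = e i j" "b = e k l"
    and d: "int d dvd (r ^ i - 1) * x + j" "int d dvd (r ^ k - 1) * x + l"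
    by (auto simp: stab_def)
  from d have "int d dvd r ^ k * ((r ^ i - 1) * x + j) + ((r ^ k - 1) * x + l)"
    by (rule_tac dvd_add[OF dvd_mult])
  also have "r ^ k * ((r ^ i - 1) * x + j) + ((r ^ k - 1) * x + l)
      = (r ^ (i + k) - 1) * x + (j * r ^ k + l)"
    by (simp add: power_add algebra_simps)
  finally show "a \<otimes> b \<in> stab d x"
    unfolding ab e_mult using assms by (simp add: mem_stab_iff)
qed

lemma translation_multiples:
  assumes "subgroup H G" "e 0 j \<in> H"
  shows "e 0 (c * j) \<in> H"
proof -
  have "e 0 j [^] k = e 0 (int k * j)" for k :: nat
    by (induction k) (simp_all add: e_one e_mult algebra_simps)
  then have nat: "e 0 (int k * j) \<in> H" for k
    using subgroup_int_pow_closed[OF assms, of "int k"] by (simp add: int_pow_int)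
  \<comment> \<open>Replacing \<open>c\<close> by its remainder modulo \<open>m\<close> makes it a
    natural number, so that negative \<open>c\<close> is covered too.\<close>
  have "[c mod int m * j = c * j] (mod int m)"
    by (simp add: cong_mult)
  then show ?thesis
    using nat[of "nat (c mod int m)"] m_pos e_eq_iff[of 0 "c mod int m * j" 0 "c * j"] by simp
qed

lemma stab_cong:
  assumes "int d dvd x - y"
  shows "stab d x = stab d y"
proof -
  have "int d dvd (r ^ i - 1) * x + j \<longleftrightarrow> int d dvd (r ^ i - 1) * y + j" for i j
  proof (rule cong_dvd_iff, rule cong_add[OF cong_mult])
    show "[x = y] (mod int d)" using assms by (simp add: cong_iff_dvd_diff)
  qed simp_all
  then show ?thesis by (simp add: stab_def)
qed

lemma stab_mono:
  assumes "d dvd d'"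
  shows "stab d' x \<subseteq> stab d x"
proof -
  have "int d dvd q" if "int d' dvd q" for q
    using assms that by (meson dvd_trans int_dvd_int_iff)
  then show ?thesis unfolding stab_def by blast
qed

text \<open>By hypothesis \<open>e 1 s\<close> fixes \<open>x\<close> modulo \<open>m\<close>, hence
  so do its powers, and the elements displayed are exactly these powers. Together they form
  \<open>stab m x\<close>, so \<open>H\<close> contains all of it.\<close>

lemma spine_in_subgroup:
  assumes "subgroup H G" "e 1 s \<in> H" "int m dvd (r - 1) * x + s"
  shows "e i (- ((r ^ i - 1) * x)) \<in> H"
proof (induction i)
  case 0
  then show ?case using assms(1) by (simp add: e_one subgroup.one_closed)
next
  case (Suc i)
  have "e 1 s = e 1 (- ((r - 1) * x))"
    using assms(3) by (simp add: e_eq_iff cong_iff_dvd_diff add.commute)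
  then have "e i (- ((r ^ i - 1) * x)) \<otimes> e 1 (- ((r - 1) * x)) \<in> H"
    using Suc assms(1,2) by (simp add: subgroup.m_closed)
  then show ?case
    by (simp add: e_mult algebra_simps)
qed

text \<open>As \<open>r - 1\<close> is a unit modulo \<open>m\<close>, each map with linear part
  \<open>r\<close> has a fixed point modulo \<open>m\<close>.\<close>

lemma solve_r1: obtains x where "int m dvd (r - 1) * x + s"
proof -
  obtain c where "[(r - 1) * c = 1] (mod int m)"
    using coprime_r1 cong_solve_coprime_int by (metis coprime_commute)
  then have "int m dvd ((r - 1) * c - 1) * (- s)"
    by (simp add: cong_iff_dvd_diff)
  then have "int m dvd (r - 1) * (- s * c) + s"
    by (simp add: algebra_simps)
  then show thesis by (rule that)
qed

lemma subgroup_cases: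
  assumes H: "subgroup H G"
  obtains (transl) d where "d dvd m" "H = transl d"
  | (stab) d x where "d dvd m" "H = stab d x"
proof -
  \<comment> \<open>The translations in \<open>H\<close>; they determine the modulus
    \<open>d\<close> in both cases.\<close>
  define J where "J = {j. e 0 j \<in> H}"
  have "e 0 (int m) = \<one>" by (simp add: e_eq_iff cong_0_iff flip: e_one)
  then have "int m \<in> J" using H by (simp add: J_def subgroup.one_closed)
  moreover have "i - j \<in> J" if "i \<in> J" "j \<in> J" for i j
  proof -
    have "e 0 i \<otimes> inv (e 0 j) \<in> H"
      using that H by (simp add: J_def subgroup.m_closed subgroup.m_inv_closed)
    also have "e 0 i \<otimes> inv (e 0 j) = e 0 (i - j)"
      by (subst inv_solve_right') (simp_all add: e_mult)
    finally show ?thesis by (simp only: J_def mem_Collect_eq)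
  qed
  ultimately obtain d where d: "d dvd m" and J_eq: "J = {j. int d dvd j}"
    by (rule int_subgroup_eq_multiples)
  have J: "e 0 j \<in> H \<longleftrightarrow> int d dvd j" for j
    using eqset_imp_iff[OF J_eq, of j] by (simp only: J_def mem_Collect_eq)
  show thesis
  proof (cases "\<exists>i j. e i j \<in> H \<and> \<not> n dvd i")
    case False
    have "H = transl d"
    proof (rule Set.set_eqI, rule iffI)
      fix a assume a: "a \<in> H"
      then obtain i j where ij: "a = e i j"
        using carrier_cases subgroup.mem_carrier[OF H] by metis
      then have "n dvd i" using False a by blast
      then have "a = e 0 j" by (simp add: ij e_eq_iff cong_0_iff)
      then show "a \<in> transl d" using a J unfolding transl_def by blast
    next
      fix a assume "a \<in> transl d"
      then show "a \<in> H" using J unfolding transl_def by blast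
    qed
    then show thesis using d by (rule that(1)[rotated])
  next
    case True
    then obtain i j where ij: "e i j \<in> H" "\<not> n dvd i" by blast
    then have "coprime i n"
      using prime_n by (metis coprime_commute prime_imp_coprime)
    then obtain k where k: "[i * k = 1] (mod n)"
      using cong_solve_coprime_nat by auto
    \<comment> \<open>Here \<open>k\<close> inverts \<open>i\<close> modulo the prime
      \<open>n\<close>, so the \<open>k\<close>-th power of \<open>e i j\<close> has
      \<open>b\<close>-exponent 1. Its \<open>a\<close>-exponent need not be known, because
      \<open>solve_r1\<close> finds a fixed point for any value.\<close>
    have "\<exists>l. e i j [^] q = e (i * q) l" for q :: nat
    proof (induction q)
      case (Suc q)
      then obtain l where "e i j [^] q = e (i * q) l" by blast
      then have "e i j [^] Suc q = e (i * Suc q) (l * r ^ i + j)"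
        by (simp add: e_mult add.commute)
      then show ?case by blast
    qed (auto simp flip: e_one)
    then obtain s where "e i j [^] k = e (i * k) s" by blast
    moreover have "e i j [^] k \<in> H"
      using H ij(1) by (simp add: subgroup_int_pow_closed flip: int_pow_int)
    ultimately have s: "e 1 s \<in> H" using k e_eq_iff[of "i * k" s 1 s] by simp
    obtain x where x: "int m dvd (r - 1) * x + s" by (rule solve_r1)
    have "e p q \<in> H \<longleftrightarrow> e p q \<in> stab d x" for p q
    proof -
      \<comment> \<open>\<open>e p c\<close> fixes \<open>x\<close> modulo \<open>m\<close> and lies
        in \<open>H\<close>. Any other element with \<open>b\<close>-exponent \<open>p\<close>
        differs from it by a translation, on which \<open>J\<close> decides membership.\<close>
      define c where "c = - ((r ^ p - 1) * x)"
      have c: "e p c \<in> H" unfolding c_def by (rule spine_in_subgroup[OF H s x])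
      have eq: "e p q = e p c \<otimes> e 0 (q - c)" by (simp add: e_mult)
      then have "inv (e p c) \<otimes> e p q = e 0 (q - c)" by (simp add: m_assoc[symmetric])
      then have "e p q \<in> H \<longleftrightarrow> e 0 (q - c) \<in> H"
        using c H eq subgroup.m_closed[OF H] subgroup.m_inv_closed[OF H] by metis
      also have "\<dots> \<longleftrightarrow> int d dvd q - c" by (rule J)
      also have "\<dots> \<longleftrightarrow> e p q \<in> stab d x"
        using d by (simp add: c_def mem_stab_iff add.commute)
      finally show ?thesis .
    qed
    then have "H = stab d x"
      using subgroup.mem_carrier[OF H] subgroup.mem_carrier[OF subgroup_stab[OF d]] carrier_cases
      by (metis subsetI subset_antisym)
    then show thesis using d by (rule that(2)[rotated])
  qed
qed

section \<open>Permuting subgroups\<close>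

lemma transl_commute:
  assumes "d dvd m" "subgroup K G"
  shows "transl d <#> K = K <#> transl d"
proof (intro Set.set_eqI iffI)
  fix a assume "a \<in> transl d <#> K"
  then obtain j k where k: "int d dvd j" "k \<in> K" "a = e 0 j \<otimes> k"
    unfolding set_mult_def transl_def by blast
  moreover obtain p q where pq: "k = e p q"
    using carrier_cases subgroup.mem_carrier[OF assms(2) k(2)] by metis
  ultimately have "a = k \<otimes> e 0 (j * r ^ p)" by (simp add: e_mult add.commute)
  moreover have "e 0 (j * r ^ p) \<in> transl d" using k(1) by (auto simp: transl_def)
  ultimately show "a \<in> K <#> transl d" using k unfolding set_mult_def by blast
next
  fix a assume "a \<in> K <#> transl d"
  then obtain j k where k: "int d dvd j" "k \<in> K" "a = k \<otimes> e 0 j"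
    unfolding set_mult_def transl_def by blast
  moreover obtain p q where pq: "k = e p q"
    using carrier_cases subgroup.mem_carrier[OF assms(2) k(2)] by metis
  \<comment> \<open>Moving a translation from right to left past \<open>e p q\<close> divides its
    exponent by \<open>r ^ p\<close>; modulo \<open>m\<close> this is multiplication by
    \<open>r ^ (p * (n - 1))\<close>.\<close>
  define j' where "j' = j * r ^ (p * (n - 1))"
  have "[j * r ^ (p + p * (n - 1)) = j * 1] (mod int m)"
    by (intro cong_mult pow_cong_1 n_dvd_add_mult cong_refl)
  then have "[j' * r ^ p + q = j + q] (mod int m)"
    by (simp add: j'_def power_add cong_add_rcancel mult_ac)
  then have "e (0 + p) (j' * r ^ p + q) = e (p + 0) (q * r ^ 0 + j)"
    by (simp add: e_eq_iff add.commute)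
  then have "a = e 0 j' \<otimes> k" using k pq by (simp add: e_mult)
  moreover have "e 0 j' \<in> transl d" using k(1) by (auto simp: transl_def j'_def)
  ultimately show "a \<in> transl d <#> K" using k unfolding set_mult_def by blast
qed

text \<open>An element of the larger stabilizer displaces \<open>z\<close> by a multiple of
  \<open>gcd u v\<close>. This splits into a multiple of \<open>u\<close> and a multiple
  \<open>w\<close> of \<open>v\<close>, and the translation by \<open>w\<close> is split off as the
  right factor.\<close>

lemma stab_mult_same_point:
  assumes "u dvd m" "v dvd m"
  shows "stab u z <#> stab v z = stab (gcd u v) z"
proof
  have g: "gcd u v dvd m" using assms by (metis dvd_trans gcd_dvd1)
  have "stab u z \<subseteq> stab (gcd u v) z" "stab v z \<subseteq> stab (gcd u v) z"
    by (simp_all add: stab_mono)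
  then show "stab u z <#> stab v z \<subseteq> stab (gcd u v) z"
    using subgroup.m_closed[OF subgroup_stab[OF g]] unfolding set_mult_def by blast
  show "stab (gcd u v) z \<subseteq> stab u z <#> stab v z"
  proof
    fix a assume "a \<in> stab (gcd u v) z"
    then obtain i j where a: "a = e i j" and "int (gcd u v) dvd (r ^ i - 1) * z + j"
      by (auto simp: stab_def)
    then have "gcd (int u) (int v) dvd ((r ^ i - 1) * z + j) - 0" by simp
    then obtain w where w: "int u dvd w - ((r ^ i - 1) * z + j)" "int v dvd w - 0"
      by (rule exists_int_cong_both)
    have "e i (j - w) \<in> stab u z"
      using w(1) assms dvd_minus_iff[of "int u" "(r ^ i - 1) * z + (j - w)"]
      by (simp add: mem_stab_iff algebra_simps)
    moreover have "e 0 w \<in> stab v z" using w(2) assms by (simp add: mem_stab_iff)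
    moreover have "a = e i (j - w) \<otimes> e 0 w" by (simp add: a e_mult)
    ultimately show "a \<in> stab u z <#> stab v z" unfolding set_mult_def by blast
  qed
qed

text \<open>If the residue classes of \<open>x\<close> and \<open>y\<close> meet in some
  \<open>z\<close>, both subgroups are stabilizers of \<open>z\<close>, and their product is
  symmetric in \<open>u\<close> and \<open>v\<close>. Conversely, commutation makes the product a
  group, which is then forced to contain too many translations unless the classes meet.\<close>

lemma stab_commute_iff:
  assumes "u dvd m" "v dvd m"
  shows "stab u x <#> stab v y = stab v y <#> stab u x \<longleftrightarrow> int (gcd u v) dvd x - y"
proof
  assume "int (gcd u v) dvd x - y"
  then have "gcd (int u) (int v) dvd x - y" by simp
  then obtain z where "int u dvd z - x" "int v dvd z - y" by (rule exists_int_cong_both)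
  then have "stab u x = stab u z" "stab v y = stab v z"
    by (simp_all add: stab_cong)
  then show "stab u x <#> stab v y = stab v y <#> stab u x"
    using assms by (simp add: stab_mult_same_point gcd.commute)
next
  assume comm: "stab u x <#> stab v y = stab v y <#> stab u x"
  define W where "W = stab u x <#> stab v y"
  define g where "g = gcd u v"
  have W: "subgroup W G"
    unfolding W_def using assms comm by (intro subgroup_set_mult subgroup_stab)
  have g: "g dvd u" "g dvd v" by (simp_all add: g_def)
  then have gm: "g dvd m" using assms dvd_trans by blast
  \<comment> \<open>A translation in \<open>W\<close> is a product of a map fixing \<open>x\<close>
    and a map fixing \<open>y\<close> modulo \<open>g\<close>, whose linear parts are inverse to
    each other modulo \<open>g\<close>. This leaves only the values
    \<open>(r ^ k - 1) * (x - y)\<close> for \<open>q\<close> modulo \<open>g\<close>.\<close>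
  have e0: "\<exists>k. int g dvd q - (r ^ k - 1) * (x - y)" if "e 0 q \<in> W" for q
  proof -
    from that obtain i j k l where eq: "e 0 q = e (i + k) (j * r ^ k + l)"
      and "int u dvd (r ^ i - 1) * x + j" "int v dvd (r ^ k - 1) * y + l"
      unfolding W_def set_mult_def stab_def by (auto simp: e_mult)
    then have "int g dvd (r ^ i - 1) * x + j" "int g dvd (r ^ k - 1) * y + l"
      using g by (meson dvd_trans int_dvd_int_iff)+
    moreover have "n dvd i + k" "int g dvd q - (j * r ^ k + l)"
      using eq gm by (auto simp: e_eq_iff cong_iff_dvd_diff cong_0_iff cong_sym_eq[of 0]
        intro: dvd_trans[of "int g" "int m"])
    moreover from this have "int g dvd r ^ (i + k) - 1"
      using gm by (intro pow_dvd_diff_1)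
    ultimately have "int g dvd (q - (j * r ^ k + l)) + r ^ k * ((r ^ i - 1) * x + j)
        + ((r ^ k - 1) * y + l) - (r ^ (i + k) - 1) * x"
      by (rule_tac dvd_diff[OF dvd_add[OF dvd_add[OF _ dvd_mult]] dvd_mult2])
    also have "\<dots> = q - (r ^ k - 1) * (x - y)"
      by (simp add: power_add algebra_simps)
    finally show ?thesis by blast
  qed
  \<comment> \<open>Chosen so that \<open>e 1 s\<close> and \<open>e 1 t\<close> fix
    \<open>x\<close> and \<open>y\<close> respectively. Their quotient is the translation by
    \<open>t - s = (r - 1) * (x - y)\<close>.\<close>
  define s t where "s = - ((r - 1) * x)" and "t = - ((r - 1) * y)"
  have st: "e 1 s \<in> stab u x" "e 1 t \<in> stab v y"
    using assms by (simp_all add: mem_stab_iff s_def t_def)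
  have "e 1 s \<in> W" "e 1 t \<in> W"
  proof -
    have one: "\<one> \<in> stab u x" "\<one> \<in> stab v y"
      using assms by (simp_all add: subgroup_stab subgroup.one_closed)
    have "e 1 s = e 1 s \<otimes> \<one>" "e 1 t = \<one> \<otimes> e 1 t" by simp_all
    then show "e 1 s \<in> W" "e 1 t \<in> W"
      unfolding W_def set_mult_def using st one by blast+
  qed
  then have "inv (e 1 s) \<otimes> e 1 t \<in> W"
    using W by (simp add: subgroup.m_closed subgroup.m_inv_closed)
  moreover have "inv (e 1 s) \<otimes> e 1 t = e 0 (t - s)"
    by (subst inv_solve_left') (simp_all add: e_mult)
  ultimately have ts: "e 0 (t - s) \<in> W" by simp
  \<comment> \<open>\<open>c\<close> is minus the inverse of \<open>r - 1\<close> modulo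
    \<open>m\<close>.\<close>
  obtain c where c: "int m dvd (r - 1) * c + 1" by (rule solve_r1)
  txt \<open>
    \<open>W\<close> contains the translation by \<open>y - x\<close>, so \<open>e0\<close> makes \<open>r ^ k * (x - y)\<close> vanish
    modulo \<open>g\<close> for some \<open>k\<close>, where \<open>r ^ k\<close> is a unit.
  \<close>
  have "e 0 (c * (t - s)) \<in> W"
    using W ts by (rule translation_multiples)
  then obtain k where "int g dvd c * (t - s) - (r ^ k - 1) * (x - y)" using e0 by blast
  moreover have "int g dvd (r - 1) * c + 1"
    using c gm by (meson dvd_trans int_dvd_int_iff)
  ultimately have "int g dvd ((r - 1) * c + 1) * (x - y) - (c * (t - s) - (r ^ k - 1) * (x - y))"
    by (rule_tac dvd_diff[OF dvd_mult2])
  also have "\<dots> = r ^ k * (x - y)"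
    by (simp add: s_def t_def algebra_simps)
  finally have "int g dvd r ^ k * (x - y)" .
  moreover have "coprime (int g) (r ^ k)"
    using coprime_pow gm by (meson coprime_divisors dvd_refl int_dvd_int_iff)
  ultimately show "int (gcd u v) dvd x - y"
    by (simp add: coprime_dvd_mult_right_iff g_def)
qed

section \<open>Counting commuting pairs\<close>

abbreviation divs :: "nat set" where
  "divs \<equiv> {d. d dvd m}"

definition stab_index :: "(nat \<times> int) set" where
  "stab_index = (SIGMA d:divs. {0..<int d})"

lemma finite_divs: "finite divs"
  using m_pos by simp

lemma finite_stab_index: "finite stab_index"
  unfolding stab_index_def using finite_divs by blast

lemma transl_eq_iff:
  assumes "d dvd m" "d' dvd m"
  shows "transl d = transl d' \<longleftrightarrow> d = d'"
proof
  assume eq: "transl d = transl d'"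
  have "e 0 (int d) \<in> transl d'" "e 0 (int d') \<in> transl d"
    using assms by (simp add: mem_transl_iff flip: eq, simp add: mem_transl_iff eq)
  then have "d' dvd d" "d dvd d'"
    using assms by (simp_all add: mem_transl_iff)
  then show "d = d'" by (simp add: dvd_antisym)
qed simp

text \<open>The translations in a stabilizer recover \<open>d\<close>. The element with
  \<open>b\<close>-exponent 1 that fixes \<open>y\<close> displaces \<open>x\<close> by
  \<open>(r - 1) * (x - y)\<close>, and \<open>r - 1\<close> is a unit modulo
  \<open>d\<close>.\<close>

lemma stab_eq_iff:
  assumes "d dvd m" "d' dvd m"
  shows "stab d x = stab d' y \<longleftrightarrow> d = d' \<and> int d dvd x - y"
proof
  assume eq: "stab d x = stab d' y"
  have "e 0 (int d) \<in> stab d' y" "e 0 (int d') \<in> stab d x"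
    using assms by (simp add: mem_stab_iff flip: eq, simp add: mem_stab_iff eq)
  then have "d' dvd d" "d dvd d'"
    using assms by (simp_all add: mem_stab_iff)
  then have d: "d = d'" by (simp add: dvd_antisym)
  have "e 1 (- ((r - 1) * y)) \<in> stab d x"
    unfolding eq using assms by (simp add: mem_stab_iff)
  then have "int d dvd (r - 1) * (x - y)"
    using assms by (simp add: mem_stab_iff right_diff_distrib)
  moreover have "coprime (int d) (r - 1)"
    using coprime_r1 assms(1) by (meson coprime_divisors dvd_refl int_dvd_int_iff)
  ultimately show "d = d' \<and> int d dvd x - y"
    using d by (simp add: coprime_dvd_mult_right_iff)
qed (use stab_cong in blast)

lemma transl_neq_stab:
  assumes "d dvd m" "d' dvd m"
  shows "transl d \<noteq> stab d' x"
proof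
  assume eq: "transl d = stab d' x"
  have "e 1 (- ((r - 1) * x)) \<in> transl d"
    unfolding eq using assms by (simp add: mem_stab_iff)
  then show False using assms n_gt_1 by (simp add: mem_transl_iff)
qed

lemma stab_mod: "stab d (x mod int d) = stab d x"
proof (rule stab_cong)
  show "int d dvd x mod int d - x" by (simp add: mod_eq_dvd_iff[symmetric])
qed

text \<open>Stabilizers depend only on \<open>x\<close> modulo \<open>d\<close>. The set
  \<open>D\<close> is left open so that the result serves for all divisors as well as for
  \<open>m\<close> alone, the cyclic case.\<close>

lemma stab_image_index:
  assumes "\<And>d. d \<in> D \<Longrightarrow> d dvd m"
  shows "{stab d x | d x. d \<in> D} = case_prod stab ` (SIGMA d:D. {0..<int d})"
proof (intro equalityI subsetI)
  fix H assume "H \<in> {stab d x | d x. d \<in> D}"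
  then obtain d x where H: "H = stab d x" "d \<in> D" by blast
  then have "d > 0" using assms m_pos dvd_pos_nat by blast
  then have "(d, x mod int d) \<in> (SIGMA d:D. {0..<int d})" using H by simp
  then show "H \<in> case_prod stab ` (SIGMA d:D. {0..<int d})"
    by (rule rev_image_eqI) (simp add: H stab_mod)
qed auto

lemma all_subgroups_eq:
  "all_subgroups G = transl ` divs \<union> case_prod stab ` stab_index"
proof -
  have "all_subgroups G = transl ` divs \<union> {stab d x | d x. d \<in> divs}"
    unfolding all_subgroups_def
    by (auto intro: subgroup_transl subgroup_stab elim!: subgroup_cases)
  then show ?thesis unfolding stab_index_def by (subst (asm) stab_image_index) auto
qed

section \<open>Cyclic subgroups\<close>

lemma generate_singleton_commute:
  assumes "h \<in> generate G {g}" "k \<in> generate G {g}" "g \<in> carrier G"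
  shows "h \<otimes> k = k \<otimes> h"
proof -
  obtain i j :: int where "h = g [^] i" "k = g [^] j"
    using assms by (auto simp: generate_pow)
  then show ?thesis using assms(3) by (simp add: int_pow_mult[symmetric] add.commute)
qed

lemma transl_cyclic:
  assumes "d dvd m"
  shows "transl d = generate G {e 0 (int d)}"
proof
  have sub: "subgroup (generate G {e 0 (int d)}) G"
    by (rule generate_is_subgroup) simp
  have mem: "e 0 (int d) \<in> generate G {e 0 (int d)}" by (simp add: generate.incl)
  show "transl d \<subseteq> generate G {e 0 (int d)}"
    using translation_multiples[OF sub mem] unfolding transl_def by (auto simp: mult.commute elim!: dvdE)
  show "generate G {e 0 (int d)} \<subseteq> transl d"
    by (rule generate_subgroup_incl[OF _ subgroup_transl])
      (use assms in \<open>simp_all add: mem_transl_iff\<close>)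
qed

lemma stab_cyclic: "stab m x = generate G {e 1 (- ((r - 1) * x))}" (is "_ = ?C")
proof
  have sub: "subgroup ?C G"
    by (rule generate_is_subgroup) simp
  show "stab m x \<subseteq> ?C"
  proof
    fix a assume "a \<in> stab m x"
    then obtain i j where "a = e i j" "int m dvd (r ^ i - 1) * x + j" by (auto simp: stab_def)
    then have "a = e i (- ((r ^ i - 1) * x))"
      by (simp add: e_eq_iff cong_iff_dvd_diff add.commute)
    also have "\<dots> \<in> ?C"
      by (rule spine_in_subgroup[OF sub]) (auto intro: generate.incl)
    finally show "a \<in> ?C" .
  qed
  show "?C \<subseteq> stab m x"
    by (rule generate_subgroup_incl[OF _ subgroup_stab]) (simp_all add: mem_stab_iff)
qed

text \<open>A cyclic group is abelian, but the translation by \<open>d\<close> commutes with an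
  element of \<open>b\<close>-exponent 1 only if \<open>m\<close> divides
  \<open>(r - 1) * d\<close>, hence only if \<open>m\<close> divides \<open>d\<close>.\<close>

lemma stab_cyclic_imp_eq:
  assumes d: "d dvd m" and "g \<in> carrier G" "stab d x = generate G {g}"
  shows "d = m"
proof -
  let ?s = "- ((r - 1) * x)"
  have "e 0 (int d) \<in> stab d x" "e 1 ?s \<in> stab d x"
    using d by (simp_all add: mem_stab_iff)
  then have "e 0 (int d) \<otimes> e 1 ?s = e 1 ?s \<otimes> e 0 (int d)"
    using assms generate_singleton_commute by metis
  then have "int m dvd int d * r - int d"
    by (simp add: e_mult e_eq_iff cong_iff_dvd_diff)
  then have "int m dvd (r - 1) * int d" by (simp add: algebra_simps)
  then have "int m dvd int d" using coprime_r1 by (simp add: coprime_dvd_mult_right_iff)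
  then show ?thesis using d by (simp add: dvd_antisym)
qed

lemma cyclic_subgroups_eq:
  "cyclic_subgroups G = transl ` divs \<union> case_prod stab ` ({m} \<times> {0..<int m})"
proof -
  have "cyclic_subgroups G = transl ` divs \<union> {stab d x | d x. d \<in> {m}}"
  proof (intro equalityI subsetI)
    fix H assume "H \<in> cyclic_subgroups G"
    then obtain g where H: "subgroup H G" "g \<in> carrier G" "H = generate G {g}"
      by (auto simp: cyclic_subgroups_def)
    from H(1) show "H \<in> transl ` divs \<union> {stab d x | d x. d \<in> {m}}"
    proof (cases rule: subgroup_cases)
      case (stab d x)
      then show ?thesis using H stab_cyclic_imp_eq[of d g x] by blast
    qed blast
  next
    fix H assume "H \<in> transl ` divs \<union> {stab d x | d x. d \<in> {m}}"
    then consider d where "d dvd m" "H = transl d" | x where "H = stab m x" by blast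
    then show "H \<in> cyclic_subgroups G"
    proof cases
      case 1
      then show ?thesis using transl_cyclic[of d] subgroup_transl[of d]
        unfolding cyclic_subgroups_def by (metis (mono_tags, lifting) e_closed mem_Collect_eq)
    next
      case 2
      then show ?thesis using stab_cyclic[of x] subgroup_stab[of m x]
        unfolding cyclic_subgroups_def by (metis (mono_tags, lifting) e_closed mem_Collect_eq dvd_refl)
    qed
  qed
  then show ?thesis by (subst (asm) stab_image_index) auto
qed

section \<open>The counts and the two degrees\<close>

lemma inj_on_stab: "inj_on (case_prod stab) stab_index"
proof (rule inj_onI, clarify)
  fix d x d' x'
  assume i: "(d, x) \<in> stab_index" "(d', x') \<in> stab_index" and "stab d x = stab d' x'"
  then have "d = d'" "int d dvd x - x'"
    by (auto simp: stab_index_def stab_eq_iff)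
  then have "d = d'" "x mod int d = x' mod int d" by (simp_all add: mod_eq_dvd_iff)
  with i show "d = d' \<and> x = x'" by (simp add: stab_index_def)
qed

text \<open>Both degrees are instances: \<open>X\<close> is \<open>stab_index\<close> for
  \<open>sd\<close> and the part with modulus \<open>m\<close> for \<open>csd\<close>. Every pair
  involving a translation subgroup commutes, so only pairs of stabilizers need the criterion of
  \<open>stab_commute_iff\<close>.\<close>

lemma
  assumes X: "X \<subseteq> stab_index" and L: "L = transl ` divs \<union> case_prod stab ` X"
  shows card_subgroup_family: "card L = card divs + card X"
    and card_commuting_pairs: "card {(H, K) \<in> L \<times> L. H <#> K = K <#> H} =
      card divs * (card divs + card X) + card X * card divs
        + card {((u, x), (v, y)) \<in> X \<times> X. int (gcd u v) dvd x - y}"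
proof -
  define T U where "T = transl ` divs" and "U = case_prod stab ` X"
  define Y where "Y = {((u, x), (v, y)) \<in> X \<times> X. int (gcd u v) dvd x - y}"
  have X_dvd: "d dvd m" if "(d, x) \<in> X" for d x using that X by (auto simp: stab_index_def)
  have finX: "finite X" using X finite_stab_index by (rule finite_subset)
  have fin: "finite T" "finite U" using finite_divs finX by (simp_all add: T_def U_def)
  have L': "L = T \<union> U" by (simp add: L T_def U_def)
  have disj: "T \<inter> U = {}" using X_dvd transl_neq_stab by (auto simp: T_def U_def)
  have cT: "card T = card divs"
    unfolding T_def by (rule card_image) (auto intro!: inj_onI simp: transl_eq_iff)
  have inj: "inj_on (case_prod stab) X" using inj_on_stab X by (rule inj_on_subset)
  have cU: "card U = card X" unfolding U_def by (rule card_image[OF inj])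
  show cL: "card L = card divs + card X"
    using fin disj by (simp add: L' card_Un_disjoint cT cU)
  \<comment> \<open>The commuting pairs of stabilizers, obtained as an injective image so that they
    can be counted on the indices.\<close>
  define C where "C = map_prod (case_prod stab) (case_prod stab) ` Y"
  note inj2 = map_prod_inj_on[OF inj inj]
  have YX: "Y \<subseteq> X \<times> X" by (auto simp: Y_def)
  have cC: "card C = card Y"
    unfolding C_def by (rule card_image[OF inj_on_subset[OF inj2 YX]])
  have "finite Y" using finite_subset[OF YX] finX by simp
  then have finC: "finite C" by (simp add: C_def)
  have CU: "C \<subseteq> U \<times> U" using YX by (auto simp: C_def U_def)
  have sub: "subgroup H G" if "H \<in> L" for H
    using that X_dvd by (auto simp: L subgroup_transl subgroup_stab)
  have T_comm: "H <#> K = K <#> H" if "H \<in> T" "K \<in> L" for H K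
    using that sub[OF that(2)] transl_commute by (auto simp: T_def)
  have U_comm: "(case_prod stab p, case_prod stab q) \<in> C \<longleftrightarrow>
      case_prod stab p <#> case_prod stab q = case_prod stab q <#> case_prod stab p"
    if "p \<in> X" "q \<in> X" for p q
  proof -
    have "(case_prod stab p, case_prod stab q) \<in> C \<longleftrightarrow> (p, q) \<in> Y"
      using inj_on_image_mem_iff[OF inj2 _ YX, of "(p, q)"] that by (simp add: C_def)
    then show ?thesis
      using that X_dvd by (auto simp: Y_def stab_commute_iff split: prod.splits)
  qed
  have "{(H, K) \<in> L \<times> L. H <#> K = K <#> H} = T \<times> L \<union> U \<times> T \<union> C"
  proof -
    have "(H, K) \<in> C \<longleftrightarrow> H <#> K = K <#> H" if "H \<in> U" "K \<in> U" for H K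
      using that U_comm unfolding U_def by blast
    moreover have "H <#> K = K <#> H" if "H \<in> T \<and> K \<in> L \<or> H \<in> L \<and> K \<in> T" for H K
      using that T_comm by metis
    ultimately show ?thesis using CU unfolding L' by blast
  qed
  moreover have "card (T \<times> L \<union> U \<times> T \<union> C) = card T * card L + card U * card T + card C"
  proof -
    have "(T \<times> L) \<inter> (U \<times> T) = {}" "(T \<times> L \<union> U \<times> T) \<inter> C = {}"
      using disj CU by blast+
    then show ?thesis
      using fin finC by (simp add: card_Un_disjoint L' card_cartesian_product)
  qed
  ultimately show "card {(H, K) \<in> L \<times> L. H <#> K = K <#> H} =
      card divs * (card divs + card X) + card X * card divs
        + card {((u, x), (v, y)) \<in> X \<times> X. int (gcd u v) dvd x - y}"
    by (simp only: cL cT cU cC Y_def)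
qed

lemma card_stab_index: "card stab_index = divisor_sigma m"
  unfolding stab_index_def divisor_sigma_def using finite_divs by simp

lemma card_compatible_index:
  "real (card {((u, x), (v, y)) \<in> stab_index \<times> stab_index. int (gcd u v) dvd x - y}) = divisor_g m"
proof -
  define S where "S = (\<lambda>(u, v). {(x, y). x \<in> {0..<int u} \<and> y \<in> {0..<int v} \<and> int (gcd u v) dvd x - y})"
  \<comment> \<open>Regrouping puts the two moduli first, so that each fibre over
    \<open>(u, v)\<close> is counted by \<open>card_compatible_residues\<close>.\<close>
  let ?f = "\<lambda>((u, v), (x, y)). ((u, x), (v, y))"
  let ?Y = "{((u, x), (v, y)) \<in> stab_index \<times> stab_index. int (gcd u v) dvd x - y}"
  have "bij_betw ?f (SIGMA p:divs \<times> divs. S p) ?Y"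
    by (rule bij_betw_byWitness[where f' = "\<lambda>((u, x), (v, y)). ((u, v), (x, y))"])
      (auto simp: S_def stab_index_def)
  then have "card ?Y = card (SIGMA p:divs \<times> divs. S p)"
    by (simp add: bij_betw_same_card)
  also have "\<dots> = (\<Sum>p\<in>divs \<times> divs. card (S p))"
  proof (rule card_SigmaI)
    show "\<forall>p\<in>divs \<times> divs. finite (S p)"
      by (auto simp: S_def intro: finite_subset[of _ "{0..<int u} \<times> {0..<int v}" for u v])
  qed (use finite_divs in simp)
  also have "\<dots> = (\<Sum>(u, v)\<in>divs \<times> divs. lcm u v)"
  proof (rule sum.cong)
    fix p assume "p \<in> divs \<times> divs"
    then obtain u v where p: "p = (u, v)" "u dvd m" "v dvd m" by auto
    then have "u > 0" "v > 0" using m_pos dvd_pos_nat by blast+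
    then show "card (S p) = (case p of (u, v) \<Rightarrow> lcm u v)"
      unfolding S_def p using card_compatible_residues by simp
  qed simp
  finally show ?thesis
    using sum_lcm_divisors[OF m_pos] by (simp add: case_prod_unfold)
qed

lemma sd_eq:
  "sd G = ((real (divisor_tau m))\<^sup>2 + 2 * real (divisor_tau m) * real (divisor_sigma m) + divisor_g m)
      / (real (divisor_tau m) + real (divisor_sigma m))\<^sup>2"
  unfolding sd_def card_commuting_pairs[OF order_refl all_subgroups_eq]
    card_subgroup_family[OF order_refl all_subgroups_eq] divisor_tau_def
  by (simp only: of_nat_add of_nat_mult of_nat_power card_compatible_index card_stab_index)
    (simp add: power2_eq_square algebra_simps)

lemma csd_eq:
  "csd G = (real (divisor_tau m) * (real (divisor_tau m) + real m)
        + real m * (real (divisor_tau m) + 1)) / (real (divisor_tau m) + real m)\<^sup>2"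
proof -
  let ?X = "{m} \<times> {0..<int m}"
  have X: "?X \<subseteq> stab_index" by (auto simp: stab_index_def)
  \<comment> \<open>Both moduli are \<open>m\<close>, and two reduced residues congruent modulo
    \<open>m\<close> are equal, so only the diagonal survives.\<close>
  have "{((u, x), (v, y)) \<in> ?X \<times> ?X. int (gcd u v) dvd x - y} = (\<lambda>p. (p, p)) ` ?X"
    by (auto simp flip: mod_eq_dvd_iff)
  then have "card {((u, x), (v, y)) \<in> ?X \<times> ?X. int (gcd u v) dvd x - y} = m"
    by (simp add: card_image inj_on_def)
  then show ?thesis
    unfolding csd_def card_commuting_pairs[OF X cyclic_subgroups_eq]
      card_subgroup_family[OF X cyclic_subgroups_eq] divisor_tau_def
    by (simp add: power2_eq_square algebra_simps)
qed

end

section \<open>Normal form in the presented group\<close>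

text \<open>Exponents of a normal form \<open>b ^ i * a ^ j\<close> of the word. A leading
  \<open>a\<close> turns into \<open>a ^ (r ^ i)\<close> on its way past \<open>b ^ i\<close>, and
  an inverse of \<open>b\<close> counts as \<open>n - 1\<close> to keep the exponent
  natural.\<close>

fun zm_coords :: "nat \<Rightarrow> nat \<Rightarrow> zm_gen word \<Rightarrow> nat \<times> int" where
  "zm_coords n r [] = (0, 0)"
| "zm_coords n r ((gen_a, s) # w) =
    (let (i, j) = zm_coords n r w in (i, (if s then 1 else - 1) * int r ^ i + j))"
| "zm_coords n r ((gen_b, s) # w) =
    (let (i, j) = zm_coords n r w in ((if s then 1 else n - 1) + i, j))"

lemma zm_coords_append:
  "zm_coords n r (u @ v) =
    (fst (zm_coords n r u) + fst (zm_coords n r v),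
     snd (zm_coords n r u) * int r ^ fst (zm_coords n r v) + snd (zm_coords n r v))"
  by (induction n r u rule: zm_coords.induct)
    (simp_all add: case_prod_unfold Let_def power_add algebra_simps)

lemma zm_coords_replicate:
  "zm_coords n r (replicate k (gen_a, True)) = (0, int k)"
  "zm_coords n r (replicate k (gen_b, True)) = (k, 0)"
  by (induction k) simp_all

definition zm_relations :: "nat \<Rightarrow> nat \<Rightarrow> nat \<Rightarrow> (zm_gen word \<times> zm_gen word) set" where
  "zm_relations m n r =
    {(replicate m (gen_a, True), []),
     (replicate n (gen_b, True), []),
     ([(gen_b, False), (gen_a, True), (gen_b, True)], replicate r (gen_a, True))}"

lemma ZM_eq: "ZM m n r = presented_group (zm_relations m n r)"
  by (simp add: ZM_def zm_relations_def)

text \<open>The defining relations and the group law respect the coordinates modulo \<open>n\<close>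
  and \<open>m\<close>, which are thus an invariant of the group element. This guarantees that the
  presented group does not collapse further.\<close>

lemma word_eq_imp_cong_coords:
  assumes "word_eq (zm_relations m n r) u v" and r: "[int r ^ n = 1] (mod int m)" and "n > 0"
  shows "[fst (zm_coords n r u) = fst (zm_coords n r v)] (mod n)
    \<and> [snd (zm_coords n r u) = snd (zm_coords n r v)] (mod int m)"
  using assms(1)
proof induction
  case (rel u v)
  then show ?case
    using \<open>n > 0\<close> by (auto simp: zm_relations_def zm_coords_replicate cong_0_iff)
next
  case (cancel x e)
  show ?case
    using \<open>n > 0\<close> by (cases x; cases e) (simp_all add: cong_0_iff)
next
  case (append u u' v v')
  then show ?case
    unfolding zm_coords_append fst_conv snd_conv
    by (blast intro: cong_add cong_mult power_cong_exponent[OF _ r])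
next
  case (sym u v)
  then show ?case by (simp add: cong_sym_eq)
next
  case (trans u v w)
  then show ?case by (meson cong_trans)
qed simp

section \<open>The presented group in terms of powers of its generators\<close>

locale zm_presentation =
  fixes m n r :: nat
  assumes m_pos: "m > 0" and n_pos: "n > 0" and r_pow_n: "[int r ^ n = 1] (mod int m)"
begin

abbreviation cls :: "zm_gen word \<Rightarrow> zm_gen word set" where
  "cls \<equiv> word_class (zm_relations m n r)"

sublocale group "ZM m n r"
  unfolding ZM_eq by (rule group_presented_group)

abbreviation \<alpha> where "\<alpha> \<equiv> cls [(gen_a, True)]"
abbreviation \<beta> where "\<beta> \<equiv> cls [(gen_b, True)]"

lemma carrier_ZM: "carrier (ZM m n r) = range cls"
  by (simp add: ZM_eq presented_group_def)

lemma cls_closed [simp]: "cls w \<in> carrier (ZM m n r)"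
  by (simp add: carrier_ZM)

lemma cls_append: "cls (u @ v) = cls u \<otimes>\<^bsub>ZM m n r\<^esub> cls v"
  by (simp add: ZM_eq presented_group_mult)

lemma cls_Nil: "cls [] = \<one>\<^bsub>ZM m n r\<^esub>"
  by (simp add: ZM_eq presented_group_def)

lemma cls_Cons: "cls (x # w) = cls [x] \<otimes>\<^bsub>ZM m n r\<^esub> cls w"
  using cls_append[of "[x]" w] by simp

lemma cls_replicate: "cls (replicate k x) = cls [x] [^]\<^bsub>ZM m n r\<^esub> k"
proof (induction k)
  case (Suc k)
  then show ?case
    using cls_append[of "replicate k x" "[x]"] by (simp add: replicate_append_same)
qed (simp add: cls_Nil)

lemma cls_relation: "(u, v) \<in> zm_relations m n r \<Longrightarrow> cls u = cls v"
  by (simp add: word_class_eq_iff word_eq.rel)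

lemma cls_inverse: "cls [(x, False)] = inv\<^bsub>ZM m n r\<^esub> (cls [(x, True)])"
proof (rule inv_equality[symmetric])
  have "cls [(x, False), (x, True)] = cls []"
    using word_eq.cancel[of _ x False] by (simp add: word_class_eq_iff)
  then show "cls [(x, False)] \<otimes>\<^bsub>ZM m n r\<^esub> cls [(x, True)] = \<one>\<^bsub>ZM m n r\<^esub>"
    by (simp add: cls_Cons[of _ "[_]"] cls_Nil)
qed simp_all

lemma \<alpha>_pow_m: "\<alpha> [^]\<^bsub>ZM m n r\<^esub> m = \<one>\<^bsub>ZM m n r\<^esub>"
  unfolding cls_replicate[symmetric] cls_Nil[symmetric]
  by (rule cls_relation) (simp add: zm_relations_def)

lemma \<beta>_pow_n: "\<beta> [^]\<^bsub>ZM m n r\<^esub> n = \<one>\<^bsub>ZM m n r\<^esub>"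
  unfolding cls_replicate[symmetric] cls_Nil[symmetric]
  by (rule cls_relation) (simp add: zm_relations_def)

lemma \<beta>_pow_cong: "[i = k] (mod n) \<Longrightarrow> \<beta> [^]\<^bsub>ZM m n r\<^esub> i = \<beta> [^]\<^bsub>ZM m n r\<^esub> k"
proof -
  assume "[i = k] (mod n)"
  moreover have "\<beta> [^]\<^bsub>ZM m n r\<^esub> i = \<beta> [^]\<^bsub>ZM m n r\<^esub> (i mod n)" for i
  proof -
    have "\<beta> [^]\<^bsub>ZM m n r\<^esub> (n * (i div n) + i mod n) = \<beta> [^]\<^bsub>ZM m n r\<^esub> (i mod n)"
      unfolding nat_pow_mult[OF cls_closed, symmetric] nat_pow_pow[OF cls_closed, symmetric] \<beta>_pow_n
      by simp
    then show ?thesis by simp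
  qed
  ultimately show ?thesis by (metis cong_def)
qed

lemma \<alpha>_pow_cong:
  fixes i k :: int
  assumes "[i = k] (mod int m)"
  shows "\<alpha> [^]\<^bsub>ZM m n r\<^esub> i = \<alpha> [^]\<^bsub>ZM m n r\<^esub> k"
proof -
  obtain q where "i = k + int m * q" using assms by (metis cong_iff_lin cong_sym)
  show ?thesis
    unfolding \<open>i = k + int m * q\<close> int_pow_mult[OF cls_closed] int_pow_pow[OF cls_closed, symmetric]
      int_pow_int \<alpha>_pow_m by simp
qed

lemma \<alpha>_\<beta>: "\<alpha> [^]\<^bsub>ZM m n r\<^esub> (j::int) \<otimes>\<^bsub>ZM m n r\<^esub> \<beta> =
  \<beta> \<otimes>\<^bsub>ZM m n r\<^esub> \<alpha> [^]\<^bsub>ZM m n r\<^esub> (j * int r)"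
proof -
  let ?G = "ZM m n r"
  have "cls ([(gen_b, False)] @ [(gen_a, True)] @ [(gen_b, True)]) = cls (replicate r (gen_a, True))"
    by (rule cls_relation) (simp add: zm_relations_def)
  then have rel: "inv\<^bsub>?G\<^esub> \<beta> \<otimes>\<^bsub>?G\<^esub> (\<alpha> \<otimes>\<^bsub>?G\<^esub> \<beta>) = \<alpha> [^]\<^bsub>?G\<^esub> r"
    unfolding cls_append cls_replicate cls_inverse .
  then have base: "\<alpha> \<otimes>\<^bsub>?G\<^esub> \<beta> = \<beta> \<otimes>\<^bsub>?G\<^esub> \<alpha> [^]\<^bsub>?G\<^esub> r"
    by (simp add: inv_solve_left')
  have nat: "\<alpha> [^]\<^bsub>?G\<^esub> k \<otimes>\<^bsub>?G\<^esub> \<beta> = \<beta> \<otimes>\<^bsub>?G\<^esub> \<alpha> [^]\<^bsub>?G\<^esub> (k * r)" for k :: nat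
  proof (induction k)
    case (Suc k)
    have "\<alpha> [^]\<^bsub>?G\<^esub> Suc k \<otimes>\<^bsub>?G\<^esub> \<beta> = \<alpha> [^]\<^bsub>?G\<^esub> k \<otimes>\<^bsub>?G\<^esub> \<beta> \<otimes>\<^bsub>?G\<^esub> \<alpha> [^]\<^bsub>?G\<^esub> r"
      by (simp add: m_assoc base)
    also have "\<dots> = \<beta> \<otimes>\<^bsub>?G\<^esub> \<alpha> [^]\<^bsub>?G\<^esub> (k * r + r)"
      by (simp add: Suc m_assoc nat_pow_mult)
    finally show ?case by (simp add: add.commute)
  qed simp
  \<comment> \<open>Negative exponents reduce to the natural case, since \<open>\<alpha>\<close> has
    order dividing \<open>m\<close>.\<close>
  have "\<alpha> [^]\<^bsub>?G\<^esub> j = \<alpha> [^]\<^bsub>?G\<^esub> (j mod int m)"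
    by (rule \<alpha>_pow_cong) simp
  also have "\<dots> = \<alpha> [^]\<^bsub>?G\<^esub> nat (j mod int m)"
    using m_pos by (simp flip: int_pow_int)
  finally have "\<alpha> [^]\<^bsub>?G\<^esub> j \<otimes>\<^bsub>?G\<^esub> \<beta> = \<beta> \<otimes>\<^bsub>?G\<^esub> \<alpha> [^]\<^bsub>?G\<^esub> (nat (j mod int m) * r)"
    by (simp only: nat)
  also have "\<alpha> [^]\<^bsub>?G\<^esub> (nat (j mod int m) * r) = \<alpha> [^]\<^bsub>?G\<^esub> ((j mod int m) * int r)"
    using m_pos by (simp flip: int_pow_int)
  also have "\<dots> = \<alpha> [^]\<^bsub>?G\<^esub> (j * int r)"
    by (rule \<alpha>_pow_cong) (simp add: cong_mult)
  finally show ?thesis .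
qed

lemma \<alpha>_\<beta>_pow: "\<alpha> [^]\<^bsub>ZM m n r\<^esub> (j::int) \<otimes>\<^bsub>ZM m n r\<^esub> \<beta> [^]\<^bsub>ZM m n r\<^esub> (k::nat) =
  \<beta> [^]\<^bsub>ZM m n r\<^esub> k \<otimes>\<^bsub>ZM m n r\<^esub> \<alpha> [^]\<^bsub>ZM m n r\<^esub> (j * int r ^ k)"
proof (induction k)
  case (Suc k)
  let ?G = "ZM m n r"
  have "\<alpha> [^]\<^bsub>?G\<^esub> j \<otimes>\<^bsub>?G\<^esub> \<beta> [^]\<^bsub>?G\<^esub> Suc k
      = \<alpha> [^]\<^bsub>?G\<^esub> j \<otimes>\<^bsub>?G\<^esub> \<beta> [^]\<^bsub>?G\<^esub> k \<otimes>\<^bsub>?G\<^esub> \<beta>"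
    by (simp add: m_assoc)
  also have "\<dots> = \<beta> [^]\<^bsub>?G\<^esub> k \<otimes>\<^bsub>?G\<^esub> (\<alpha> [^]\<^bsub>?G\<^esub> (j * int r ^ k) \<otimes>\<^bsub>?G\<^esub> \<beta>)"
    by (simp add: Suc m_assoc)
  also have "\<dots> = \<beta> [^]\<^bsub>?G\<^esub> Suc k \<otimes>\<^bsub>?G\<^esub> \<alpha> [^]\<^bsub>?G\<^esub> (j * int r ^ k * int r)"
    by (simp add: \<alpha>_\<beta> m_assoc)
  finally show ?case by (simp add: mult_ac)
qed simp

definition elt :: "nat \<Rightarrow> int \<Rightarrow> zm_gen word set" where
  "elt i j = \<beta> [^]\<^bsub>ZM m n r\<^esub> i \<otimes>\<^bsub>ZM m n r\<^esub> \<alpha> [^]\<^bsub>ZM m n r\<^esub> j"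

lemma elt_mult: "elt i j \<otimes>\<^bsub>ZM m n r\<^esub> elt k l = elt (i + k) (j * int r ^ k + l)"
proof -
  let ?G = "ZM m n r"
  have "elt i j \<otimes>\<^bsub>?G\<^esub> elt k l = \<beta> [^]\<^bsub>?G\<^esub> i \<otimes>\<^bsub>?G\<^esub>
      (\<alpha> [^]\<^bsub>?G\<^esub> j \<otimes>\<^bsub>?G\<^esub> \<beta> [^]\<^bsub>?G\<^esub> k) \<otimes>\<^bsub>?G\<^esub> \<alpha> [^]\<^bsub>?G\<^esub> l"
    by (simp add: elt_def m_assoc)
  also have "\<dots> = (\<beta> [^]\<^bsub>?G\<^esub> i \<otimes>\<^bsub>?G\<^esub> \<beta> [^]\<^bsub>?G\<^esub> k) \<otimes>\<^bsub>?G\<^esub>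
      (\<alpha> [^]\<^bsub>?G\<^esub> (j * int r ^ k) \<otimes>\<^bsub>?G\<^esub> \<alpha> [^]\<^bsub>?G\<^esub> l)"
    by (simp add: \<alpha>_\<beta>_pow m_assoc)
  finally show ?thesis by (simp add: elt_def nat_pow_mult int_pow_mult)
qed

lemma cls_eq_elt: "cls w = elt (fst (zm_coords n r w)) (snd (zm_coords n r w))"
proof (induction w)
  case Nil
  show ?case by (simp add: elt_def cls_Nil)
next
  case (Cons x w)
  obtain y s where x: "x = (y, s)" by (cases x)
  have a: "cls [(gen_a, s)] = elt 0 (if s then 1 else - 1)"
    by (auto simp: elt_def cls_inverse int_pow_neg int_pow_1)
  have "\<beta> [^]\<^bsub>ZM m n r\<^esub> (n - 1) \<otimes>\<^bsub>ZM m n r\<^esub> \<beta> = \<one>\<^bsub>ZM m n r\<^esub>"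
    using \<beta>_pow_n n_pos by (simp flip: nat_pow_Suc)
  then have "inv\<^bsub>ZM m n r\<^esub> \<beta> = \<beta> [^]\<^bsub>ZM m n r\<^esub> (n - 1)"
    by (rule inv_equality) simp_all
  then have b: "cls [(gen_b, s)] = elt (if s then 1 else n - 1) 0"
    by (auto simp: elt_def cls_inverse)
  show ?case
    by (subst cls_Cons, cases y)
      (simp_all add: Cons x a b elt_mult case_prod_unfold Let_def)
qed

lemma elt_eq_iff: "elt i j = elt k l \<longleftrightarrow> [i = k] (mod n) \<and> [j = l] (mod int m)"
proof
  \<comment> \<open>A word without inverse letters that represents \<open>elt i j\<close> and has
    explicit coordinates, so that the invariant of \<open>word_eq\<close> separates distinct normal
    forms.\<close>
  define word where "word = (\<lambda>i j. replicate i (gen_b, True) @ replicate (nat (j mod int m)) (gen_a, True))"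
  have coords: "zm_coords n r (word i j) = (i, j mod int m)" for i j
    using m_pos by (simp add: word_def zm_coords_append zm_coords_replicate)
  have elt: "elt i j = cls (word i j)" for i j
  proof -
    have "\<alpha> [^]\<^bsub>ZM m n r\<^esub> j = \<alpha> [^]\<^bsub>ZM m n r\<^esub> (j mod int m)"
      by (rule \<alpha>_pow_cong) simp
    then have "elt i j = elt i (j mod int m)" by (simp only: elt_def)
    also have "\<dots> = cls (word i j)" by (simp only: cls_eq_elt[of "word i j"] coords fst_conv snd_conv)
    finally show ?thesis .
  qed
  assume "elt i j = elt k l"
  then have "word_eq (zm_relations m n r) (word i j) (word k l)"
    unfolding elt word_class_eq_iff .
  from word_eq_imp_cong_coords[OF this r_pow_n n_pos]
  show "[i = k] (mod n) \<and> [j = l] (mod int m)"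
    by (simp add: coords)
next
  assume "[i = k] (mod n) \<and> [j = l] (mod int m)"
  then show "elt i j = elt k l"
    by (simp add: elt_def \<beta>_pow_cong[of i k] \<alpha>_pow_cong[of j l])
qed

lemma carrier_eq_elt: "carrier (ZM m n r) = {elt i j | i j. True}"
proof -
  have "cls w \<in> {elt i j | i j. True}" for w
    by (subst cls_eq_elt) blast
  moreover have "elt i j \<in> carrier (ZM m n r)" for i j
    by (simp add: elt_def)
  ultimately show ?thesis unfolding carrier_ZM by fast
qed

end

lemma affine_coordinates_ZM:
  assumes "m > 0" "prime n" "coprime (int m) (int r - 1)" "[int r ^ n = 1] (mod int m)"
  shows "affine_coordinates (ZM m n r) m n (int r) (zm_presentation.elt m n r)"
proof -
  interpret zm_presentation m n r
    using assms prime_gt_0_nat by unfold_locales auto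
  show ?thesis
    using assms elt_mult elt_eq_iff carrier_eq_elt by unfold_locales auto
qed

theorem proposition4p5:
  fixes m n r :: nat
  assumes "m \<ge> 1" and "n \<ge> 1"
    and "gcd m n = 1" and "gcd (int m) (int r - 1) = 1"
    and "[r ^ n = 1] (mod m)"
    and "prime n"
  shows "sd (ZM m n r) =
      ((real (divisor_tau m))\<^sup>2 + 2 * real (divisor_tau m) * real (divisor_sigma m) + divisor_g m)
      / (real (divisor_tau m) + real (divisor_sigma m))\<^sup>2
    \<and> csd (ZM m n r) =
      (real (divisor_tau m) * (real (divisor_tau m) + real m)
        + real m * (real (divisor_tau m) + 1))
      / (real (divisor_tau m) + real m)\<^sup>2"
proof -
  have coprime_r1: "coprime (int m) (int r - 1)"
    using assms(4) by (simp add: coprime_iff_gcd_eq_1)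
  have r_pow_n: "[int r ^ n = 1] (mod int m)"
    using assms(5) cong_int_iff[of "r ^ n" 1 m] by simp
  interpret affine_coordinates "ZM m n r" m n "int r" "zm_presentation.elt m n r"
    using assms(1,6) coprime_r1 r_pow_n by (intro affine_coordinates_ZM) simp_all
  show ?thesis
    using sd_eq csd_eq by blast
qed

end
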